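(* Let $T>0$ and let $H:[0,T]\to(0,1)$ be a Hölder continuous function with exponent $\gamma>\sup_{t\in[0,T]}H(t)$. For any $t\in[0,T]$, the time-varying fractional Brownian motion $B^{H(\cdot)}$ with Hurst function $H$ satisfies $$\mathbb{E}\left[\left(B^{H(\cdot)}(t)\right)^2\right]=t^{2H(t)}.$$
   Context: A function $H:[0,T]\to(0,1)$ is Hölder continuous with exponent $\gamma>0$ if there is $C>0$ with $|H(t)-H(s)|\le C|t-s|^\gamma$ for all $t,s\in[0,T]$. Time-varying fractional Brownian motion (TV-fBm): for $H:[0,T]\to(0,1)$ Hölder continuous with exponent $\gamma>\sup_{t\in[0,T]}H(t)$ (a standing condition in the definition of TV-fBm) and $\{B_s\}_{s\ge0}$ a standard Brownian motion, $$B^{H(\cdot)}(t):=\sqrt{2H(t)}\int_0^t(t-s)^{H(t)-1/2}\,dB_s,\qquad t\in[0,T],$$ where the integral is the Itô integral of a deterministic integrand. *)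

theory Defs
  imports "HOL-Probability.Probability"
begin

definition holder_continuous_on :: "real set \<Rightarrow> real \<Rightarrow> (real \<Rightarrow> real) \<Rightarrow> bool" where
  "holder_continuous_on S \<gamma> f \<longleftrightarrow>
     \<gamma> > 0 \<and> (\<exists>C>0. \<forall>t\<in>S. \<forall>s\<in>S. \<bar>f t - f s\<bar> \<le> C * \<bar>t - s\<bar> powr \<gamma>)"

text \<open>Processes are functions \<open>real \<Rightarrow> 'a \<Rightarrow> real\<close> of which only the values at nonnegative times
  matter.\<close>

definition natural_filtration ::
    "'a measure \<Rightarrow> (real \<Rightarrow> 'a \<Rightarrow> real) \<Rightarrow> real \<Rightarrow> 'a measure" where
  "natural_filtration M B t =
     sigma (space M) (\<Union>s\<in>{0..t}. {B s -` A \<inter> space M | A. A \<in> sets borel})"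

text \<open>Independence of increments is stated as independence of \<open>B t - B s\<close> from the past up to
  time \<open>s\<close>. The scale parameter of \<open>normal_density\<close> is the standard deviation, so \<open>B t - B s\<close>
  has variance \<open>t - s\<close>.\<close>

locale standard_brownian_motion = prob_space M
  for M :: "'a measure" +
  fixes B :: "real \<Rightarrow> 'a \<Rightarrow> real"
  assumes measurable: "\<And>t. 0 \<le> t \<Longrightarrow> B t \<in> borel_measurable M"
    and starts_at_0: "AE \<omega> in M. B 0 \<omega> = 0"
    and increment_indep_past: "\<And>s t. 0 \<le> s \<Longrightarrow> s < t \<Longrightarrow>
      indep_set (sets (natural_filtration M B s))
        {(\<lambda>\<omega>. B t \<omega> - B s \<omega>) -` A \<inter> space M | A. A \<in> sets borel}"
    and increment_normal: "\<And>s t. 0 \<le> s \<Longrightarrow> s < t \<Longrightarrow>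
      distributed M lborel (\<lambda>\<omega>. B t \<omega> - B s \<omega>) (\<lambda>x. ennreal (normal_density 0 (sqrt (t - s)) x))"
    and continuous_paths: "AE \<omega> in M. continuous_on {0..} (\<lambda>t. B t \<omega>)"

text \<open>A simple process is given by a number of intervals \<open>n\<close>, partition points
  \<open>\<tau> 0 \<le> \<dots> \<le> \<tau> n\<close> in \<open>[0, t]\<close> and, for \<open>i < n\<close>, a bounded coefficient \<open>\<xi> i\<close> which is measurable
  with respect to the information available at the left endpoint \<open>\<tau> i\<close>.\<close>

definition adapted_simple ::
    "'a measure \<Rightarrow> (real \<Rightarrow> 'a \<Rightarrow> real) \<Rightarrow> real \<Rightarrow> nat \<Rightarrow> (nat \<Rightarrow> real) \<Rightarrow> (nat \<Rightarrow> 'a \<Rightarrow> real) \<Rightarrow> bool" where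
  "adapted_simple M B t n \<tau> \<xi> \<longleftrightarrow>
     0 \<le> \<tau> 0 \<and> \<tau> n \<le> t \<and> (\<forall>i<n. \<tau> i \<le> \<tau> (Suc i)) \<and>
     (\<forall>i<n. \<xi> i \<in> borel_measurable (natural_filtration M B (\<tau> i)) \<and> bounded (\<xi> i ` space M))"

definition simple_process ::
    "nat \<Rightarrow> (nat \<Rightarrow> real) \<Rightarrow> (nat \<Rightarrow> 'a \<Rightarrow> real) \<Rightarrow> real \<Rightarrow> 'a \<Rightarrow> real" where
  "simple_process n \<tau> \<xi> s \<omega> = (\<Sum>i<n. \<xi> i \<omega> * indicator {\<tau> i<..\<tau> (Suc i)} s)"

definition simple_ito_integral ::
    "(real \<Rightarrow> 'a \<Rightarrow> real) \<Rightarrow> nat \<Rightarrow> (nat \<Rightarrow> real) \<Rightarrow> (nat \<Rightarrow> 'a \<Rightarrow> real) \<Rightarrow> 'a \<Rightarrow> real" where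
  "simple_ito_integral B n \<tau> \<xi> \<omega> = (\<Sum>i<n. \<xi> i \<omega> * (B (\<tau> (Suc i)) \<omega> - B (\<tau> i) \<omega>))"

text \<open>\<open>X\<close> is a version of \<open>\<integral>\<^sub>0\<^sup>t u dB\<close>: the \<open>L\<^sup>2(M)\<close> limit of the integrals of adapted simple
  processes converging to \<open>u\<close> in \<open>L\<^sup>2([0,t] \<times> M)\<close>.\<close>

definition is_ito_integral ::
    "'a measure \<Rightarrow> (real \<Rightarrow> 'a \<Rightarrow> real) \<Rightarrow> real \<Rightarrow> (real \<Rightarrow> 'a \<Rightarrow> real) \<Rightarrow> ('a \<Rightarrow> real) \<Rightarrow> bool" where
  "is_ito_integral M B t u X \<longleftrightarrow>
     case_prod u \<in> borel_measurable (restrict_space borel {0..t} \<Otimes>\<^sub>M M) \<and>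
     (\<forall>s\<in>{0..t}. u s \<in> borel_measurable (natural_filtration M B s)) \<and>
     X \<in> borel_measurable M \<and> integrable M (\<lambda>\<omega>. (X \<omega>)\<^sup>2) \<and>
     (\<exists>n \<tau> \<xi>.
        (\<forall>k. adapted_simple M B t (n k) (\<tau> k) (\<xi> k)) \<and>
        (\<lambda>k. \<integral>\<^sup>+\<omega>. (\<integral>\<^sup>+s\<in>{0..t}.
               ennreal ((u s \<omega> - simple_process (n k) (\<tau> k) (\<xi> k) s \<omega>)\<^sup>2) \<partial>lborel) \<partial>M)
          \<longlonglongrightarrow> 0 \<and>
        (\<lambda>k. \<integral>\<^sup>+\<omega>. ennreal ((X \<omega> - simple_ito_integral B (n k) (\<tau> k) (\<xi> k) \<omega>)\<^sup>2) \<partial>M)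
          \<longlonglongrightarrow> 0)"

text \<open>The integral is determined only up to almost sure equality; a version is chosen.\<close>

definition ito_integral ::
    "'a measure \<Rightarrow> (real \<Rightarrow> 'a \<Rightarrow> real) \<Rightarrow> real \<Rightarrow> (real \<Rightarrow> 'a \<Rightarrow> real) \<Rightarrow> 'a \<Rightarrow> real" where
  "ito_integral M B t u = (SOME X. is_ito_integral M B t u X)"

text \<open>At \<open>s = t\<close> the integrand takes the conventional value \<open>0 powr a = 0\<close>, which is immaterial:
  a single time point is a null set.\<close>

definition tv_fbm ::
    "'a measure \<Rightarrow> (real \<Rightarrow> 'a \<Rightarrow> real) \<Rightarrow> (real \<Rightarrow> real) \<Rightarrow> real \<Rightarrow> 'a \<Rightarrow> real" where
  "tv_fbm M B H t \<omega> =
     sqrt (2 * H t) * ito_integral M B t (\<lambda>s _. (t - s) powr (H t - 1/2)) \<omega>"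

end

theory Submission
  imports Defs
begin

text \<open>Put \<open>h = H t\<close> and \<open>u s = (t - s) powr (h - 1/2)\<close>. For fixed \<open>t\<close> the kernel \<open>u\<close> is a deterministic
  function with \<open>\<integral>\<^sub>0\<^sup>t u\<^sup>2 = t powr (2 * h) / (2 * h)\<close>, so by the Ito isometry
  \<open>E[(\<integral> u dB)\<^sup>2] = \<integral>\<^sub>0\<^sup>t u\<^sup>2\<close> the factor \<open>2 * h\<close> in the definition of the process cancels.

  The stochastic integral is a chosen version, so two facts are required: every version satisfies the
  isometry (\<open>ito_isometry\<close>), and some version exists (\<open>power_kernel_ito_integral_exists\<close>).

  For the isometry, the last increment of a simple process is independent of everything before it,
  and induction on the number of intervals gives the identity for simple processes. Both sides are
  squared \<open>L\<^sup>2\<close> norms and hence continuous under \<open>L\<^sup>2\<close> convergence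
  (\<open>nn_integral_power2_le_of_L2_limits\<close>).

  For existence, approximate \<open>u\<close> in \<open>L\<^sup>2\<close> by step functions \<open>\<phi>\<^sub>k\<close> with integrals \<open>S\<^sub>k\<close>. The covariance
  of Brownian motion gives \<open>E[(S\<^sub>j - S\<^sub>k)\<^sup>2] = \<integral> (\<phi>\<^sub>j - \<phi>\<^sub>k)\<^sup>2\<close> even when the two partitions are
  unrelated, so a subsequence of \<open>S\<^sub>k\<close> is rapidly Cauchy in \<open>L\<^sup>2\<close> and converges
  (\<open>L2_complete\<close>). The kernel may blow up at \<open>s = t\<close> (when \<open>h < 1/2\<close>), but it is monotone on
  \<open>[0, t)\<close>, so step functions taking the smaller endpoint value of each interval stay below it, and
  dominated convergence applies.\<close>

section \<open>Mean square convergence\<close>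

lemma power2_le_weighted:
  fixes x y \<epsilon> :: real
  assumes "0 < \<epsilon>"
  shows "x\<^sup>2 \<le> (1 + \<epsilon>) * y\<^sup>2 + (1 + 1 / \<epsilon>) * (x - y)\<^sup>2"
proof -
  have "0 \<le> (\<epsilon> * y - (x - y))\<^sup>2 / \<epsilon>" using assms by simp
  also have "\<dots> = (1 + \<epsilon>) * y\<^sup>2 + (1 + 1 / \<epsilon>) * (x - y)\<^sup>2 - x\<^sup>2"
    using assms by (simp add: field_simps power2_eq_square)
  finally show ?thesis by simp
qed

text \<open>A form of the triangle inequality of \<open>L\<^sup>2\<close> that avoids square roots and so can be stated directly
  for \<open>ennreal\<close>-valued integrals. With small \<open>\<epsilon>\<close> it compares norms sharply; \<open>\<epsilon> = 1\<close> gives the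
  usual crude bound.\<close>
lemma nn_integral_power2_le_weighted:
  fixes f g :: "'b \<Rightarrow> real"
  assumes [measurable]: "f \<in> borel_measurable N" "g \<in> borel_measurable N" and "0 < \<epsilon>"
  shows "(\<integral>\<^sup>+x. ennreal ((f x)\<^sup>2) \<partial>N) \<le>
    ennreal (1 + \<epsilon>) * (\<integral>\<^sup>+x. ennreal ((g x)\<^sup>2) \<partial>N) +
    ennreal (1 + 1 / \<epsilon>) * (\<integral>\<^sup>+x. ennreal ((f x - g x)\<^sup>2) \<partial>N)"
proof -
  have "ennreal ((f x)\<^sup>2) \<le>
     ennreal (1 + \<epsilon>) * ennreal ((g x)\<^sup>2) + ennreal (1 + 1 / \<epsilon>) * ennreal ((f x - g x)\<^sup>2)" for x
    using power2_le_weighted[OF assms(3), of "f x" "g x"] assms(3)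
    by (simp add: ennreal_mult[symmetric] ennreal_plus[symmetric] del: ennreal_plus)
  then have "(\<integral>\<^sup>+x. ennreal ((f x)\<^sup>2) \<partial>N) \<le>
    (\<integral>\<^sup>+x. ennreal (1 + \<epsilon>) * ennreal ((g x)\<^sup>2) + ennreal (1 + 1 / \<epsilon>) * ennreal ((f x - g x)\<^sup>2) \<partial>N)"
    by (intro nn_integral_mono)
  then show ?thesis by (simp add: nn_integral_add nn_integral_cmult)
qed

text \<open>Inequalities between squared \<open>L\<^sup>2\<close> norms, even over two different measure spaces, survive \<open>L\<^sup>2\<close>
  limits: going from \<open>f\<close> to \<open>f' k\<close> and from \<open>g' k\<close> to \<open>g\<close> costs a factor \<open>1 + \<epsilon>\<close> each plus an error
  that vanishes with \<open>k\<close>, and then \<open>\<epsilon>\<close> is sent to \<open>0\<close>.\<close>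
lemma nn_integral_power2_le_of_L2_limits:
  fixes f :: "'b \<Rightarrow> real" and g :: "'c \<Rightarrow> real"
  assumes [measurable]: "f \<in> borel_measurable P" "\<And>k. f' k \<in> borel_measurable P"
      "g \<in> borel_measurable Q" "\<And>k. g' k \<in> borel_measurable Q"
    and le: "\<And>k::nat. (\<integral>\<^sup>+x. ennreal ((f' k x)\<^sup>2) \<partial>P) \<le> (\<integral>\<^sup>+y. ennreal ((g' k y)\<^sup>2) \<partial>Q)"
    and f: "(\<lambda>k. \<integral>\<^sup>+x. ennreal ((f x - f' k x)\<^sup>2) \<partial>P) \<longlonglongrightarrow> 0"
    and g: "(\<lambda>k. \<integral>\<^sup>+y. ennreal ((g y - g' k y)\<^sup>2) \<partial>Q) \<longlonglongrightarrow> 0"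
  shows "(\<integral>\<^sup>+x. ennreal ((f x)\<^sup>2) \<partial>P) \<le> (\<integral>\<^sup>+y. ennreal ((g y)\<^sup>2) \<partial>Q)"
    (is "?F \<le> ?G")
proof -
  let ?d = "\<lambda>k. \<integral>\<^sup>+x. ennreal ((f x - f' k x)\<^sup>2) \<partial>P"
  let ?e = "\<lambda>k. \<integral>\<^sup>+y. ennreal ((g y - g' k y)\<^sup>2) \<partial>Q"
  have eps: "?F \<le> ennreal ((1 + \<epsilon>) * (1 + \<epsilon>)) * ?G" if "0 < \<epsilon>" for \<epsilon> :: real
  proof -
    let ?a = "ennreal (1 + \<epsilon>)" and ?c = "ennreal (1 + 1 / \<epsilon>)"
    have "?F \<le> ?a * (?a * ?G + ?c * ?e k) + ?c * ?d k" for k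
    proof -
      have "?F \<le> ?a * (\<integral>\<^sup>+x. ennreal ((f' k x)\<^sup>2) \<partial>P) + ?c * ?d k"
        using that by (intro nn_integral_power2_le_weighted) auto
      also have "\<dots> \<le> ?a * (\<integral>\<^sup>+y. ennreal ((g' k y)\<^sup>2) \<partial>Q) + ?c * ?d k"
        by (intro add_mono mult_left_mono le) auto
      also have "(\<integral>\<^sup>+y. ennreal ((g' k y)\<^sup>2) \<partial>Q) \<le> ?a * ?G + ?c * ?e k"
        using nn_integral_power2_le_weighted[of "g' k" Q g, OF _ _ that]
        by (simp add: power2_commute)
      finally show ?thesis by (simp add: add_mono mult_left_mono)
    qed
    moreover have "(\<lambda>k. ?a * (?a * ?G + ?c * ?e k) + ?c * ?d k) \<longlonglongrightarrow> ?a * (?a * ?G + ?c * 0) + ?c * 0"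
      by (intro tendsto_add ennreal_tendsto_cmult tendsto_const f g) auto
    ultimately have "?F \<le> ?a * (?a * ?G + ?c * 0) + ?c * 0"
      by (intro LIMSEQ_le_const) auto
    also have "\<dots> = ennreal ((1 + \<epsilon>) * (1 + \<epsilon>)) * ?G"
      using that by (simp add: mult.assoc ennreal_mult)
    finally show ?thesis .
  qed
  show ?thesis
  proof (cases "?G = \<infinity>")
    case False
    then obtain r where r: "0 \<le> r" "?G = ennreal r" by (cases ?G) auto
    have "(\<lambda>k. ennreal ((1 + inverse (real (Suc k))) * (1 + inverse (real (Suc k))) * r))
        \<longlonglongrightarrow> ennreal ((1 + 0) * (1 + 0) * r)"
      by (intro tendsto_ennrealI tendsto_intros LIMSEQ_inverse_real_of_nat)
    moreover have "?F \<le> ennreal ((1 + inverse (real (Suc k))) * (1 + inverse (real (Suc k))) * r)" for k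
      using eps[of "inverse (real (Suc k))"] r by (simp add: ennreal_mult)
    ultimately have "?F \<le> ennreal ((1 + 0) * (1 + 0) * r)" by (intro LIMSEQ_le_const) auto
    then show ?thesis using r by simp
  qed simp
qed

lemma ennreal_tendsto_0_mono:
  fixes f g :: "nat \<Rightarrow> ennreal"
  assumes "g \<longlonglongrightarrow> 0" "\<And>k. f k \<le> g k"
  shows "f \<longlonglongrightarrow> 0"
  by (rule tendsto_sandwich[OF _ _ tendsto_const assms(1)]) (auto simp: assms(2))

text \<open>The Riesz-Fischer argument: geometric decay makes the sum of \<open>\<bar>X (Suc k) - X k\<bar>\<close> integrable,
  hence finite almost surely, so the sequence converges almost surely; Fatou's lemma transfers the
  Cauchy bounds to the limit.\<close>
lemma (in prob_space) L2_complete: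
  fixes X :: "nat \<Rightarrow> 'a \<Rightarrow> real"
  assumes X[measurable]: "\<And>k. X k \<in> borel_measurable M" and c: "0 \<le> c"
    and cauchy: "\<And>j k. k \<le> j \<Longrightarrow> (\<integral>\<^sup>+\<omega>. ennreal ((X j \<omega> - X k \<omega>)\<^sup>2) \<partial>M) \<le> ennreal (c * (1/4) ^ k)"
  obtains Y where "Y \<in> borel_measurable M"
    "\<And>k. (\<integral>\<^sup>+\<omega>. ennreal ((Y \<omega> - X k \<omega>)\<^sup>2) \<partial>M) \<le> ennreal (c * (1/4) ^ k)"
proof
  let ?d = "\<lambda>k \<omega>. X (Suc k) \<omega> - X k \<omega>"
  let ?Y = "\<lambda>\<omega>. lim (\<lambda>k. X k \<omega>)"
  show Y[measurable]: "?Y \<in> borel_measurable M" by measurable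
  have L1: "(\<integral>\<^sup>+\<omega>. ennreal \<bar>?d k \<omega>\<bar> \<partial>M) \<le> ennreal ((c + 1) * (1/2) ^ k)" for k
  proof -
    let ?a = "2 ^ k :: real"
    \<comment> \<open>A bound of the first moment by the second; the weight \<open>2 ^ k\<close> balances the decay \<open>(1/4) ^ k\<close>.\<close>
    have "\<bar>x\<bar> \<le> ?a * x\<^sup>2 + 1 / ?a" for x :: real
    proof -
      have "0 \<le> (?a * \<bar>x\<bar> - 1)\<^sup>2 / ?a + \<bar>x\<bar>" by simp
      also have "\<dots> = ?a * x\<^sup>2 + 1 / ?a - \<bar>x\<bar>"
        by (simp add: power2_diff power_mult_distrib add_divide_distrib diff_divide_distrib)
           (simp add: power2_eq_square)
      finally show ?thesis by simp
    qed
    then have "ennreal \<bar>?d k \<omega>\<bar> \<le> ennreal ?a * ennreal ((?d k \<omega>)\<^sup>2) + ennreal (1 / ?a)" for \<omega>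
      by (simp add: ennreal_mult[symmetric] ennreal_plus[symmetric] del: ennreal_plus)
    then have "(\<integral>\<^sup>+\<omega>. ennreal \<bar>?d k \<omega>\<bar> \<partial>M)
        \<le> (\<integral>\<^sup>+\<omega>. ennreal ?a * ennreal ((?d k \<omega>)\<^sup>2) + ennreal (1 / ?a) \<partial>M)"
      by (intro nn_integral_mono)
    also have "\<dots> = ennreal ?a * (\<integral>\<^sup>+\<omega>. ennreal ((?d k \<omega>)\<^sup>2) \<partial>M) + ennreal (1 / ?a)"
      by (simp add: nn_integral_add nn_integral_cmult emeasure_space_1)
    also have "\<dots> \<le> ennreal ?a * ennreal (c * (1/4) ^ k) + ennreal (1 / ?a)"
      by (intro add_mono mult_left_mono cauchy) auto
    also have "\<dots> = ennreal (?a * (c * (1/4) ^ k) + 1 / ?a)"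
      using c by (simp add: ennreal_mult[symmetric] ennreal_plus[symmetric] del: ennreal_plus)
    also have "?a * (c * (1/4) ^ k) + 1 / ?a = (c + 1) * (1/2) ^ k"
    proof -
      have "?a * (1/4) ^ k = (1/2) ^ k" by (simp add: power_mult_distrib[symmetric])
      then have "?a * (c * (1/4) ^ k) = c * (1/2) ^ k" by (simp only: mult.left_commute[of ?a])
      then show ?thesis by (simp only:) (simp add: add_divide_distrib power_one_over)
    qed
    finally show ?thesis .
  qed
  have "(\<integral>\<^sup>+\<omega>. (\<Sum>k. ennreal \<bar>?d k \<omega>\<bar>) \<partial>M) = (\<Sum>k. \<integral>\<^sup>+\<omega>. ennreal \<bar>?d k \<omega>\<bar> \<partial>M)"
    by (rule nn_integral_suminf) measurable
  also have "\<dots> \<le> (\<Sum>k. ennreal ((c + 1) * (1/2) ^ k))"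
    by (intro suminf_le L1) auto
  also have "\<dots> = ennreal (\<Sum>k. (c + 1) * (1/2) ^ k)"
    using c by (intro suminf_ennreal2 summable_mult summable_geometric) auto
  also have "\<dots> < \<infinity>" by simp
  finally have "AE \<omega> in M. (\<Sum>k. ennreal \<bar>?d k \<omega>\<bar>) \<noteq> \<infinity>"
    by (intro nn_integral_PInf_AE) auto
  then have conv: "AE \<omega> in M. (\<lambda>k. X k \<omega>) \<longlonglongrightarrow> ?Y \<omega>"
  proof (rule AE_mp, intro AE_I2 impI)
    fix \<omega> assume "(\<Sum>k. ennreal \<bar>?d k \<omega>\<bar>) \<noteq> \<infinity>"
    then have "summable (\<lambda>k. \<bar>?d k \<omega>\<bar>)" by (intro summable_suminf_not_top) auto
    then have "summable (\<lambda>k. ?d k \<omega>)" by (rule summable_rabs_cancel)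
    then have "(\<lambda>n. \<Sum>k<n. ?d k \<omega>) \<longlonglongrightarrow> (\<Sum>k. ?d k \<omega>)" by (rule summable_LIMSEQ)
    then have "(\<lambda>n. X n \<omega> - X 0 \<omega>) \<longlonglongrightarrow> (\<Sum>k. ?d k \<omega>)"
      by (simp only: sum_lessThan_telescope[of "\<lambda>k. X k \<omega>"])
    then have "(\<lambda>n. (X n \<omega> - X 0 \<omega>) + X 0 \<omega>) \<longlonglongrightarrow> (\<Sum>k. ?d k \<omega>) + X 0 \<omega>"
      by (intro tendsto_add tendsto_const)
    then have "convergent (\<lambda>n. X n \<omega>)" by (auto simp: convergent_def)
    then show "(\<lambda>k. X k \<omega>) \<longlonglongrightarrow> ?Y \<omega>" by (simp add: convergent_LIMSEQ_iff)
  qed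
  fix k
  have "(\<integral>\<^sup>+\<omega>. ennreal ((?Y \<omega> - X k \<omega>)\<^sup>2) \<partial>M) =
      (\<integral>\<^sup>+\<omega>. liminf (\<lambda>j. ennreal ((X j \<omega> - X k \<omega>)\<^sup>2)) \<partial>M)"
  proof (rule nn_integral_cong_AE, rule AE_mp[OF conv], intro AE_I2 impI)
    fix \<omega> assume "(\<lambda>k. X k \<omega>) \<longlonglongrightarrow> ?Y \<omega>"
    then have "(\<lambda>j. ennreal ((X j \<omega> - X k \<omega>)\<^sup>2)) \<longlonglongrightarrow> ennreal ((?Y \<omega> - X k \<omega>)\<^sup>2)"
      by (intro tendsto_ennrealI tendsto_intros)
    then show "ennreal ((?Y \<omega> - X k \<omega>)\<^sup>2) = liminf (\<lambda>j. ennreal ((X j \<omega> - X k \<omega>)\<^sup>2))"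
      by (intro lim_imp_Liminf[symmetric]) auto
  qed
  also have "\<dots> \<le> liminf (\<lambda>j. \<integral>\<^sup>+\<omega>. ennreal ((X j \<omega> - X k \<omega>)\<^sup>2) \<partial>M)"
    by (intro nn_integral_liminf) auto
  also have "\<dots> \<le> limsup (\<lambda>j. \<integral>\<^sup>+\<omega>. ennreal ((X j \<omega> - X k \<omega>)\<^sup>2) \<partial>M)"
    by (intro Liminf_le_Limsup) auto
  also have "\<dots> \<le> ennreal (c * (1/4) ^ k)"
    by (intro Limsup_bounded eventually_sequentiallyI[of k] cauchy)
  finally show "(\<integral>\<^sup>+\<omega>. ennreal ((?Y \<omega> - X k \<omega>)\<^sup>2) \<partial>M) \<le> ennreal (c * (1/4) ^ k)" .
qed

section \<open>Brownian increments and the natural filtration\<close>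

lemma space_natural_filtration [simp]: "space (natural_filtration M B s) = space M"
  by (simp add: natural_filtration_def space_measure_of_conv)

lemma sets_natural_filtration:
  "sets (natural_filtration M B s) =
     sigma_sets (space M) (\<Union>r\<in>{0..s}. {B r -` A \<inter> space M | A. A \<in> sets borel})"
  unfolding natural_filtration_def by (rule sets_measure_of) auto

lemma sets_natural_filtration_mono:
  assumes "r \<le> s"
  shows "sets (natural_filtration M B r) \<subseteq> sets (natural_filtration M B s)"
  unfolding sets_natural_filtration using assms by (intro sigma_sets_mono') fastforce

lemma borel_measurable_natural_filtration_mono:
  assumes "Y \<in> borel_measurable (natural_filtration M B r)" "r \<le> s"
  shows "Y \<in> borel_measurable (natural_filtration M B s)"
  using assms sets_natural_filtration_mono[OF assms(2)] by (auto simp: measurable_def)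

lemma borel_measurable_natural_filtration_past:
  assumes "0 \<le> r" "r \<le> s"
  shows "B r \<in> borel_measurable (natural_filtration M B s)"
proof (rule measurableI)
  fix A :: "real set" assume "A \<in> sets borel"
  then show "B r -` A \<inter> space (natural_filtration M B s) \<in> sets (natural_filtration M B s)"
    unfolding sets_natural_filtration space_natural_filtration
    using assms by (intro sigma_sets.Basic UN_I[of r]) auto
qed simp

context standard_brownian_motion
begin

lemma natural_filtration_subalgebra:
  "sets (natural_filtration M B s) \<subseteq> sets M"
  unfolding sets_natural_filtration
  by (intro sets.sigma_sets_subset) (auto intro: measurable_sets[OF measurable])

lemma borel_measurable_of_natural_filtration:
  assumes "Y \<in> borel_measurable (natural_filtration M B s)"
  shows "Y \<in> borel_measurable M"
  using assms natural_filtration_subalgebra[of s] by (auto simp: measurable_def)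

text \<open>The locale asserts independence of two set systems; this is its form for random variables,
  which makes the product rule for expectations applicable.\<close>
lemma increment_indep_var:
  assumes "0 \<le> s" "s < t" "Y \<in> borel_measurable (natural_filtration M B s)"
  shows "indep_var borel Y borel (\<lambda>\<omega>. B t \<omega> - B s \<omega>)"
proof -
  let ?D = "\<lambda>\<omega>. B t \<omega> - B s \<omega>"
  have D[measurable]: "?D \<in> borel_measurable M"
    using measurable[of s] measurable[of t] assms by auto
  have sub: "{Y -` A \<inter> space M |A. A \<in> sets borel} \<subseteq> sets (natural_filtration M B s)"
    using assms(3) by (auto simp: measurable_def)
  have "indep_set {Y -` A \<inter> space M |A. A \<in> sets borel} {?D -` A \<inter> space M | A. A \<in> sets borel}"
    using increment_indep_past[OF assms(1,2)] sub
    unfolding indep_set_def by (elim indep_sets_mono_sets) (auto split: bool.split)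
  moreover have "Int_stable {f -` A \<inter> space M | A. A \<in> sets borel}" for f :: "'a \<Rightarrow> real"
  proof (rule Int_stableI)
    fix a b assume "a \<in> {f -` A \<inter> space M |A. A \<in> sets borel}" "b \<in> {f -` A \<inter> space M |A. A \<in> sets borel}"
    then obtain A A' where "a = f -` A \<inter> space M" "b = f -` A' \<inter> space M" "A \<in> sets borel" "A' \<in> sets borel"
      by auto
    then have "a \<inter> b = f -` (A \<inter> A') \<inter> space M" "A \<inter> A' \<in> sets borel" by auto
    then show "a \<inter> b \<in> {f -` A \<inter> space M |A. A \<in> sets borel}" by blast
  qed
  ultimately show ?thesis
    unfolding indep_var_eq
    using borel_measurable_of_natural_filtration[OF assms(3)] D
    by (auto intro!: indep_set_sigma_sets)
qed

lemma increment_moments: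
  assumes "0 \<le> s" "s \<le> t"
  shows integrable_increment: "integrable M (\<lambda>\<omega>. B t \<omega> - B s \<omega>)"
    and integral_increment: "(\<integral>\<omega>. B t \<omega> - B s \<omega> \<partial>M) = 0"
    and integrable_increment_sq: "integrable M (\<lambda>\<omega>. (B t \<omega> - B s \<omega>)\<^sup>2)"
    and integral_increment_sq: "(\<integral>\<omega>. (B t \<omega> - B s \<omega>)\<^sup>2 \<partial>M) = t - s"
proof -
  let ?D = "\<lambda>\<omega>. B t \<omega> - B s \<omega>"
  have *: "integrable M ?D \<and> integral\<^sup>L M ?D = 0 \<and> integrable M (\<lambda>\<omega>. (?D \<omega>)\<^sup>2)
      \<and> (\<integral>\<omega>. (?D \<omega>)\<^sup>2 \<partial>M) = t - s"
  proof (cases "s = t")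
    case False
    then have st: "s < t" using assms by simp
    then have \<sigma>: "0 < sqrt (t - s)" by simp
    note d = increment_normal[OF assms(1) st]
    have 1: "(\<integral>x. normal_density 0 (sqrt (t - s)) x * x ^ k \<partial>lborel) = (\<integral>\<omega>. ?D \<omega> ^ k \<partial>M)"
      "integrable M (\<lambda>\<omega>. ?D \<omega> ^ k)" for k
      using distributed_integral[OF d, of "\<lambda>x. x ^ k"] distributed_integrable[OF d, of "\<lambda>x. x ^ k"]
        integrable_normal_moment[OF \<sigma>, of 0 k] by auto
    show ?thesis
      using 1[of 1] 1[of 2] integral_normal_moment_odd[OF \<sigma>, of 0 0]
        integral_normal_moment_even[OF \<sigma>, of 0 1] st
      by (simp add: power2_eq_square[symmetric])
  qed simp
  show "integrable M ?D" "integral\<^sup>L M ?D = 0" "integrable M (\<lambda>\<omega>. (?D \<omega>)\<^sup>2)"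
     "(\<integral>\<omega>. (?D \<omega>)\<^sup>2 \<partial>M) = t - s" using * by auto
qed

text \<open>The two martingale facts behind the isometry: given the past, an increment has mean \<open>0\<close> and
  second moment \<open>t - s\<close>.\<close>
lemma past_times_increment:
  assumes "0 \<le> s" "s \<le> t" "Y \<in> borel_measurable (natural_filtration M B s)" "integrable M Y"
  shows integrable_past_times_increment: "integrable M (\<lambda>\<omega>. Y \<omega> * (B t \<omega> - B s \<omega>))"
    and integral_past_times_increment: "(\<integral>\<omega>. Y \<omega> * (B t \<omega> - B s \<omega>) \<partial>M) = 0"
    and integrable_past_times_increment_sq: "integrable M (\<lambda>\<omega>. Y \<omega> * (B t \<omega> - B s \<omega>)\<^sup>2)"
    and integral_past_times_increment_sq:
      "(\<integral>\<omega>. Y \<omega> * (B t \<omega> - B s \<omega>)\<^sup>2 \<partial>M) = (\<integral>\<omega>. Y \<omega> \<partial>M) * (t - s)"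
proof -
  let ?D = "\<lambda>\<omega>. B t \<omega> - B s \<omega>"
  have *: "integrable M (\<lambda>\<omega>. Y \<omega> * ?D \<omega>) \<and> (\<integral>\<omega>. Y \<omega> * ?D \<omega> \<partial>M) = 0
     \<and> integrable M (\<lambda>\<omega>. Y \<omega> * (?D \<omega>)\<^sup>2) \<and> (\<integral>\<omega>. Y \<omega> * (?D \<omega>)\<^sup>2 \<partial>M) = (\<integral>\<omega>. Y \<omega> \<partial>M) * (t - s)"
  proof (cases "s = t")
    case False
    then have st: "s < t" using assms by simp
    have iv: "indep_var borel Y borel ?D" by (rule increment_indep_var[OF assms(1) st assms(3)])
    have iv2: "indep_var borel Y borel (\<lambda>\<omega>. (?D \<omega>)\<^sup>2)"
      using indep_var_compose[OF iv, of "\<lambda>x. x" borel "\<lambda>x. x\<^sup>2" borel] by (simp add: comp_def)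
    note m = increment_moments[OF assms(1,2)]
    show ?thesis
      using indep_var_integrable[OF iv assms(4) m(1)] indep_var_lebesgue_integral[OF iv assms(4) m(1)]
        indep_var_integrable[OF iv2 assms(4) m(3)] indep_var_lebesgue_integral[OF iv2 assms(4) m(3)] m(2,4)
      by simp
  qed simp
  show "integrable M (\<lambda>\<omega>. Y \<omega> * ?D \<omega>)" "(\<integral>\<omega>. Y \<omega> * ?D \<omega> \<partial>M) = 0"
    "integrable M (\<lambda>\<omega>. Y \<omega> * (?D \<omega>)\<^sup>2)" "(\<integral>\<omega>. Y \<omega> * (?D \<omega>)\<^sup>2 \<partial>M) = (\<integral>\<omega>. Y \<omega> \<partial>M) * (t - s)"
    using * by auto
qed

end

section \<open>Simple processes and the Ito isometry\<close>

lemma partition_mono: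
  fixes \<tau> :: "nat \<Rightarrow> real"
  assumes "\<forall>i<n. \<tau> i \<le> \<tau> (Suc i)" "i \<le> j" "j \<le> n"
  shows "\<tau> i \<le> \<tau> j"
  using assms(2,3)
proof (induction j rule: dec_induct)
  case (step m)
  then have "\<tau> i \<le> \<tau> m" "\<tau> m \<le> \<tau> (Suc m)" using assms(1) by auto
  then show ?case by (rule order_trans)
qed simp

text \<open>The intervals are disjoint, so all mixed terms of the square vanish.\<close>
lemma simple_process_power2:
  assumes "\<forall>i<n. \<tau> i \<le> \<tau> (Suc i)"
  shows "(simple_process n \<tau> \<xi> s \<omega>)\<^sup>2 = (\<Sum>i<n. (\<xi> i \<omega>)\<^sup>2 * indicator {\<tau> i<..\<tau> (Suc i)} s)"
  using assms
proof (induction n)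
  case (Suc n)
  have z: "indicator {\<tau> i<..\<tau> (Suc i)} s * indicator {\<tau> n<..\<tau> (Suc n)} s = (0::real)" if "i < n" for i
    using partition_mono[OF Suc.prems, of "Suc i" n] that by (auto simp: indicator_def)
  have "simple_process n \<tau> \<xi> s \<omega> * indicator {\<tau> n<..\<tau> (Suc n)} s = 0"
    unfolding simple_process_def sum_distrib_right mult.assoc using z by (intro sum.neutral) simp
  then have cross: "simple_process n \<tau> \<xi> s \<omega> * (\<xi> n \<omega> * indicator {\<tau> n<..\<tau> (Suc n)} s) = 0"
    by (simp add: mult.left_commute)
  have "(simple_process (Suc n) \<tau> \<xi> s \<omega>)\<^sup>2 =
      (simple_process n \<tau> \<xi> s \<omega> + \<xi> n \<omega> * indicator {\<tau> n<..\<tau> (Suc n)} s)\<^sup>2"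
    by (simp add: simple_process_def)
  also have "\<dots> = (simple_process n \<tau> \<xi> s \<omega>)\<^sup>2 + (\<xi> n \<omega> * indicator {\<tau> n<..\<tau> (Suc n)} s)\<^sup>2"
    using cross by (simp add: power2_sum)
  also have "(\<xi> n \<omega> * indicator {\<tau> n<..\<tau> (Suc n)} s)\<^sup>2 = (\<xi> n \<omega>)\<^sup>2 * indicator {\<tau> n<..\<tau> (Suc n)} s"
    by (simp add: indicator_def)
  finally show ?case using Suc by simp
qed (simp add: simple_process_def)

lemma nn_integral_simple_process_power2:
  assumes mono: "\<forall>i<n. \<tau> i \<le> \<tau> (Suc i)" and "0 \<le> \<tau> 0" "\<tau> n \<le> t"
  shows "(\<integral>\<^sup>+s\<in>{0..t}. ennreal ((simple_process n \<tau> \<xi> s \<omega>)\<^sup>2) \<partial>lborel) =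
    ennreal (\<Sum>i<n. (\<xi> i \<omega>)\<^sup>2 * (\<tau> (Suc i) - \<tau> i))"
proof -
  have sub: "{\<tau> i<..\<tau> (Suc i)} \<subseteq> {0..t}" if "i < n" for i
    using partition_mono[OF mono, of 0 i] partition_mono[OF mono, of "Suc i" n] that assms by auto
  have "(\<integral>\<^sup>+s\<in>{0..t}. ennreal ((simple_process n \<tau> \<xi> s \<omega>)\<^sup>2) \<partial>lborel) =
      (\<integral>\<^sup>+s. (\<Sum>i<n. ennreal ((\<xi> i \<omega>)\<^sup>2) * indicator {\<tau> i<..\<tau> (Suc i)} s) \<partial>lborel)"
  proof (intro nn_integral_cong)
    fix s
    have "ennreal ((simple_process n \<tau> \<xi> s \<omega>)\<^sup>2) =
        (\<Sum>i<n. ennreal ((\<xi> i \<omega>)\<^sup>2) * indicator {\<tau> i<..\<tau> (Suc i)} s)"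
      unfolding simple_process_power2[OF mono]
      by (subst sum_ennreal[symmetric]) (auto intro!: sum.cong simp: indicator_def)
    moreover have "indicator {\<tau> i<..\<tau> (Suc i)} s * indicator {0..t} s
        = (indicator {\<tau> i<..\<tau> (Suc i)} s :: ennreal)" if "i < n" for i
      using sub[OF that] by (auto simp: indicator_def)
    ultimately show "ennreal ((simple_process n \<tau> \<xi> s \<omega>)\<^sup>2) * indicator {0..t} s =
        (\<Sum>i<n. ennreal ((\<xi> i \<omega>)\<^sup>2) * indicator {\<tau> i<..\<tau> (Suc i)} s)"
      by (simp only: sum_distrib_right mult.assoc) (intro sum.cong refl; simp)
  qed
  also have "\<dots> = (\<Sum>i<n. ennreal ((\<xi> i \<omega>)\<^sup>2 * (\<tau> (Suc i) - \<tau> i)))"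
  proof (subst nn_integral_sum)
    show "(\<Sum>i<n. \<integral>\<^sup>+s. ennreal ((\<xi> i \<omega>)\<^sup>2) * indicator {\<tau> i<..\<tau> (Suc i)} s \<partial>lborel) =
        (\<Sum>i<n. ennreal ((\<xi> i \<omega>)\<^sup>2 * (\<tau> (Suc i) - \<tau> i)))"
      using mono by (intro sum.cong) (auto simp: nn_integral_cmult ennreal_mult)
  qed simp
  also have "\<dots> = ennreal (\<Sum>i<n. (\<xi> i \<omega>)\<^sup>2 * (\<tau> (Suc i) - \<tau> i))"
    using mono by (intro sum_ennreal) auto
  finally show ?thesis .
qed

context standard_brownian_motion
begin

text \<open>Split off the last summand \<open>\<xi> n * D\<close>, where \<open>D\<close> is the last increment. The sum of the others is known
  at time \<open>\<tau> n\<close>, so the mixed term has mean \<open>0\<close> and \<open>E[(\<xi> n * D)\<^sup>2] = E[(\<xi> n)\<^sup>2] (\<tau> (Suc n) - \<tau> n)\<close>.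
  Measurability and square integrability must be carried through the same induction, since the
  mixed term can only be treated when they are known.\<close>
lemma simple_ito_integral_moments:
  assumes "0 \<le> \<tau> 0" "\<forall>i<n. \<tau> i \<le> \<tau> (Suc i)"
    and "\<forall>i<n. \<xi> i \<in> borel_measurable (natural_filtration M B (\<tau> i)) \<and> bounded (\<xi> i ` space M)"
  shows "simple_ito_integral B n \<tau> \<xi> \<in> borel_measurable (natural_filtration M B (\<tau> n)) \<and>
    integrable M (\<lambda>\<omega>. (simple_ito_integral B n \<tau> \<xi> \<omega>)\<^sup>2) \<and>
    integrable M (\<lambda>\<omega>. \<Sum>i<n. (\<xi> i \<omega>)\<^sup>2 * (\<tau> (Suc i) - \<tau> i)) \<and>
    (\<integral>\<omega>. (simple_ito_integral B n \<tau> \<xi> \<omega>)\<^sup>2 \<partial>M) = (\<integral>\<omega>. (\<Sum>i<n. (\<xi> i \<omega>)\<^sup>2 * (\<tau> (Suc i) - \<tau> i)) \<partial>M)"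
  using assms
proof (induction n)
  case 0
  then show ?case by (simp add: simple_ito_integral_def[abs_def])
next
  case (Suc n)
  let ?S = "simple_ito_integral B n \<tau> \<xi>"
  let ?D = "\<lambda>\<omega>. B (\<tau> (Suc n)) \<omega> - B (\<tau> n) \<omega>"
  let ?q = "\<lambda>\<omega>. \<Sum>i<n. (\<xi> i \<omega>)\<^sup>2 * (\<tau> (Suc i) - \<tau> i)"
  have IH: "?S \<in> borel_measurable (natural_filtration M B (\<tau> n))"
     "integrable M (\<lambda>\<omega>. (?S \<omega>)\<^sup>2)" "integrable M ?q"
     "(\<integral>\<omega>. (?S \<omega>)\<^sup>2 \<partial>M) = (\<integral>\<omega>. ?q \<omega> \<partial>M)"
    using Suc by auto
  have t: "0 \<le> \<tau> n" "\<tau> n \<le> \<tau> (Suc n)"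
    using partition_mono[OF Suc.prems(2), of 0 n] Suc.prems by auto
  have \<xi>: "\<xi> n \<in> borel_measurable (natural_filtration M B (\<tau> n))" using Suc.prems by auto
  obtain c where c: "\<And>\<omega>. \<omega> \<in> space M \<Longrightarrow> \<bar>\<xi> n \<omega>\<bar> \<le> c"
    using Suc.prems(3) by (force simp: bounded_iff)
  note [measurable] = borel_measurable_of_natural_filtration[OF \<xi>]
    borel_measurable_of_natural_filtration[OF IH(1)]
  have iS: "integrable M ?S" by (rule square_integrable_imp_integrable[OF _ IH(2)]) simp
  have i1: "integrable M (\<lambda>\<omega>. ?S \<omega> * \<xi> n \<omega>)"
  proof (rule Bochner_Integration.integrable_bound)
    show "integrable M (\<lambda>\<omega>. c * ?S \<omega>)" using iS by simp
    show "AE \<omega> in M. norm (?S \<omega> * \<xi> n \<omega>) \<le> norm (c * ?S \<omega>)"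
    proof (rule AE_I2)
      fix \<omega> assume "\<omega> \<in> space M"
      from c[OF this] have "\<bar>\<xi> n \<omega>\<bar> \<le> \<bar>c\<bar>" by simp
      then show "norm (?S \<omega> * \<xi> n \<omega>) \<le> norm (c * ?S \<omega>)"
        by (simp add: abs_mult mult.commute[of "\<bar>c\<bar>"] mult_left_mono)
    qed
  qed simp
  have i2: "integrable M (\<lambda>\<omega>. (\<xi> n \<omega>)\<^sup>2)"
  proof (rule integrable_const_bound[where B="c\<^sup>2"])
    show "AE \<omega> in M. norm ((\<xi> n \<omega>)\<^sup>2) \<le> c\<^sup>2"
    proof (rule AE_I2)
      fix \<omega> assume "\<omega> \<in> space M"
      from c[OF this] have "\<bar>\<xi> n \<omega>\<bar> \<le> \<bar>c\<bar>" by simp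
      then show "norm ((\<xi> n \<omega>)\<^sup>2) \<le> c\<^sup>2" by (simp only: abs_le_square_iff) simp
    qed
  qed simp
  have m1: "(\<lambda>\<omega>. ?S \<omega> * \<xi> n \<omega>) \<in> borel_measurable (natural_filtration M B (\<tau> n))"
    using IH(1) \<xi> by measurable
  have m2: "(\<lambda>\<omega>. (\<xi> n \<omega>)\<^sup>2) \<in> borel_measurable (natural_filtration M B (\<tau> n))"
    using \<xi> by measurable
  note p1 = past_times_increment[OF t m1 i1] and p2 = past_times_increment[OF t m2 i2]
  have S': "simple_ito_integral B (Suc n) \<tau> \<xi> = (\<lambda>\<omega>. ?S \<omega> + \<xi> n \<omega> * ?D \<omega>)"
    by (simp add: simple_ito_integral_def[abs_def])
  have sq: "(?S \<omega> + \<xi> n \<omega> * ?D \<omega>)\<^sup>2 =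
      (?S \<omega>)\<^sup>2 + 2 * (?S \<omega> * \<xi> n \<omega> * ?D \<omega>) + (\<xi> n \<omega>)\<^sup>2 * (?D \<omega>)\<^sup>2" for \<omega>
    by (simp add: power2_sum power_mult_distrib)
  have "(\<lambda>\<omega>. ?S \<omega> + \<xi> n \<omega> * ?D \<omega>) \<in> borel_measurable (natural_filtration M B (\<tau> (Suc n)))"
    using borel_measurable_natural_filtration_mono[OF IH(1) t(2)]
      borel_measurable_natural_filtration_mono[OF \<xi> t(2)]
      borel_measurable_natural_filtration_past[OF t, of B M]
      borel_measurable_natural_filtration_past[of "\<tau> (Suc n)" "\<tau> (Suc n)" B M] t
    by (intro borel_measurable_add borel_measurable_times borel_measurable_diff) auto
  then show ?case
    unfolding S' sq using IH p1 p2 i2 by simp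
qed

lemma simple_ito_isometry:
  assumes "adapted_simple M B t n \<tau> \<xi>"
  shows "(\<integral>\<^sup>+\<omega>. ennreal ((simple_ito_integral B n \<tau> \<xi> \<omega>)\<^sup>2) \<partial>M) =
    (\<integral>\<^sup>+\<omega>. (\<integral>\<^sup>+s\<in>{0..t}. ennreal ((simple_process n \<tau> \<xi> s \<omega>)\<^sup>2) \<partial>lborel) \<partial>M)"
proof -
  have a: "0 \<le> \<tau> 0" "\<tau> n \<le> t" "\<forall>i<n. \<tau> i \<le> \<tau> (Suc i)"
    "\<forall>i<n. \<xi> i \<in> borel_measurable (natural_filtration M B (\<tau> i)) \<and> bounded (\<xi> i ` space M)"
    using assms by (auto simp: adapted_simple_def)
  note m = simple_ito_integral_moments[OF a(1,3,4)]
  have "(\<integral>\<^sup>+\<omega>. ennreal (\<Sum>i<n. (\<xi> i \<omega>)\<^sup>2 * (\<tau> (Suc i) - \<tau> i)) \<partial>M) =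
      ennreal (\<integral>\<omega>. (\<Sum>i<n. (\<xi> i \<omega>)\<^sup>2 * (\<tau> (Suc i) - \<tau> i)) \<partial>M)"
    using m a(3) by (intro nn_integral_eq_integral) (auto intro!: sum_nonneg)
  then show ?thesis
    using m by (simp add: nn_integral_simple_process_power2[OF a(3,1,2)] nn_integral_eq_integral)
qed

text \<open>The identity for simple processes passes to the limit on the two sides separately: on \<open>M\<close> and on
  the product of Lebesgue measure on \<open>[0, t]\<close> with \<open>M\<close>.\<close>
lemma ito_isometry:
  assumes "is_ito_integral M B t u X"
  shows "(\<integral>\<^sup>+\<omega>. ennreal ((X \<omega>)\<^sup>2) \<partial>M) =
    (\<integral>\<^sup>+\<omega>. (\<integral>\<^sup>+s\<in>{0..t}. ennreal ((u s \<omega>)\<^sup>2) \<partial>lborel) \<partial>M)"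
proof -
  let ?L = "restrict_space lborel {0..t}"
  let ?Q = "?L \<Otimes>\<^sub>M M"
  interpret L: sigma_finite_measure ?L
    by (rule sigma_finite_measure_restrict_space) (auto intro: lborel.sigma_finite_measure_axioms)
  interpret LM: pair_sigma_finite ?L M ..
  have iter: "(\<integral>\<^sup>+\<omega>. (\<integral>\<^sup>+s\<in>{0..t}. ennreal ((h s \<omega>)\<^sup>2) \<partial>lborel) \<partial>M) =
      (\<integral>\<^sup>+p. ennreal ((case_prod h p)\<^sup>2) \<partial>?Q)"
    if [measurable]: "case_prod h \<in> borel_measurable ?Q" for h :: "real \<Rightarrow> 'a \<Rightarrow> real"
  proof -
    have "(\<integral>\<^sup>+p. ennreal ((case_prod h p)\<^sup>2) \<partial>?Q) = (\<integral>\<^sup>+\<omega>. (\<integral>\<^sup>+s. ennreal ((case_prod h (s, \<omega>))\<^sup>2) \<partial>?L) \<partial>M)"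
      by (rule LM.nn_integral_snd[symmetric]) measurable
    then show ?thesis by (simp add: nn_integral_restrict_space)
  qed
  have sQ: "sets (restrict_space borel {0..t} \<Otimes>\<^sub>M M) = sets ?Q"
    by (intro sets_pair_measure_cong sets_restrict_space_cong) auto
  from assms obtain n \<tau> \<xi> where u: "case_prod u \<in> borel_measurable ?Q"
    and X: "X \<in> borel_measurable M"
    and ad: "\<And>k::nat. adapted_simple M B t (n k) (\<tau> k) (\<xi> k)"
    and lu: "(\<lambda>k. \<integral>\<^sup>+\<omega>. (\<integral>\<^sup>+s\<in>{0..t}.
               ennreal ((u s \<omega> - simple_process (n k) (\<tau> k) (\<xi> k) s \<omega>)\<^sup>2) \<partial>lborel) \<partial>M) \<longlonglongrightarrow> 0"
    and lX: "(\<lambda>k. \<integral>\<^sup>+\<omega>. ennreal ((X \<omega> - simple_ito_integral B (n k) (\<tau> k) (\<xi> k) \<omega>)\<^sup>2) \<partial>M) \<longlonglongrightarrow> 0"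
    unfolding is_ito_integral_def by (auto simp: measurable_cong_sets[OF sQ refl])
  let ?\<phi> = "\<lambda>k. simple_process (n k) (\<tau> k) (\<xi> k)"
  let ?S = "\<lambda>k. simple_ito_integral B (n k) (\<tau> k) (\<xi> k)"
  have S: "?S k \<in> borel_measurable M" for k
  proof -
    have "0 \<le> \<tau> k 0" "\<forall>i<n k. \<tau> k i \<le> \<tau> k (Suc i)"
      "\<forall>i<n k. \<xi> k i \<in> borel_measurable (natural_filtration M B (\<tau> k i)) \<and> bounded (\<xi> k i ` space M)"
      using ad[of k] by (simp_all add: adapted_simple_def)
    from simple_ito_integral_moments[OF this] show ?thesis
      by (intro borel_measurable_of_natural_filtration) (rule conjunct1)
  qed
  have \<phi>: "case_prod (?\<phi> k) \<in> borel_measurable ?Q" for k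
  proof -
    have "(\<lambda>p. \<xi> k i (snd p) * indicator {\<tau> k i<..\<tau> k (Suc i)} (fst p)) \<in> borel_measurable ?Q"
      if "i < n k" for i
    proof -
      have [measurable]: "\<xi> k i \<in> borel_measurable M"
        using ad[of k] that by (auto simp: adapted_simple_def intro: borel_measurable_of_natural_filtration)
      have "(\<lambda>s. indicator {\<tau> k i<..\<tau> k (Suc i)} s :: real) \<in> borel_measurable ?L"
        by (intro measurable_restrict_space1) simp
      from measurable_compose[OF measurable_fst this] show ?thesis by measurable
    qed
    then show ?thesis
      unfolding simple_process_def case_prod_beta by (intro borel_measurable_sum) auto
  qed
  have iso: "(\<integral>\<^sup>+\<omega>. ennreal ((?S k \<omega>)\<^sup>2) \<partial>M) = (\<integral>\<^sup>+p. ennreal ((case_prod (?\<phi> k) p)\<^sup>2) \<partial>?Q)" for k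
    unfolding simple_ito_isometry[OF ad] by (rule iter[OF \<phi>])
  have diff: "case_prod (\<lambda>s \<omega>. u s \<omega> - ?\<phi> k s \<omega>) = (\<lambda>p. case_prod u p - case_prod (?\<phi> k) p)" for k
    by auto
  have "case_prod (\<lambda>s \<omega>. u s \<omega> - ?\<phi> k s \<omega>) \<in> borel_measurable ?Q" for k
    unfolding diff by (rule borel_measurable_diff[OF u \<phi>])
  from lu[unfolded iter[OF this]]
  have lu': "(\<lambda>k. \<integral>\<^sup>+p. ennreal ((case_prod u p - case_prod (?\<phi> k) p)\<^sup>2) \<partial>?Q) \<longlonglongrightarrow> 0"
    unfolding diff .
  have "(\<integral>\<^sup>+\<omega>. ennreal ((X \<omega>)\<^sup>2) \<partial>M) = (\<integral>\<^sup>+p. ennreal ((case_prod u p)\<^sup>2) \<partial>?Q)"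
  proof (rule antisym)
    show "(\<integral>\<^sup>+\<omega>. ennreal ((X \<omega>)\<^sup>2) \<partial>M) \<le> (\<integral>\<^sup>+p. ennreal ((case_prod u p)\<^sup>2) \<partial>?Q)"
      by (rule nn_integral_power2_le_of_L2_limits[OF X S u \<phi> eq_refl[OF iso] lX lu'])
    show "(\<integral>\<^sup>+p. ennreal ((case_prod u p)\<^sup>2) \<partial>?Q) \<le> (\<integral>\<^sup>+\<omega>. ennreal ((X \<omega>)\<^sup>2) \<partial>M)"
      by (rule nn_integral_power2_le_of_L2_limits[OF u \<phi> X S eq_refl[OF iso[symmetric]] lu' lX])
  qed
  then show ?thesis by (simp add: iter[OF u])
qed

end

section \<open>Ito integrals of deterministic functions\<close>

text \<open>The four minima are the covariances that appear when a product of two Brownian increments is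
  expanded.\<close>
lemma integral_indicator_greaterThanAtMost_product:
  fixes a b c d :: real
  assumes "a \<le> b" "c \<le> d"
  shows "integrable lborel (\<lambda>s. indicator {a<..b} s * indicator {c<..d} s :: real)"
    and "(\<integral>s. indicator {a<..b} s * indicator {c<..d} s \<partial>lborel) =
      min b d - min b c - min a d + min a c"
proof -
  have *: "(\<lambda>s. indicator {a<..b} s * indicator {c<..d} s :: real) = indicator {max a c<..min b d}"
    by (auto simp: indicator_def)
  show "integrable lborel (\<lambda>s. indicator {a<..b} s * indicator {c<..d} s :: real)"
    unfolding * by (cases "max a c \<le> min b d") auto
  show "(\<integral>s. indicator {a<..b} s * indicator {c<..d} s \<partial>lborel) =
      min b d - min b c - min a d + min a c"
    unfolding * using assms by (cases "max a c \<le> min b d") auto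
qed

context standard_brownian_motion
begin

text \<open>Subtracting \<open>B 0\<close>, which is \<open>0\<close> almost surely, keeps the argument free of exceptional null sets.\<close>
lemma brownian_covariance:
  assumes "0 \<le> p" "0 \<le> q"
  shows "integrable M (\<lambda>\<omega>. (B p \<omega> - B 0 \<omega>) * (B q \<omega> - B 0 \<omega>)) \<and>
    (\<integral>\<omega>. (B p \<omega> - B 0 \<omega>) * (B q \<omega> - B 0 \<omega>) \<partial>M) = min p q"
proof -
  have ordered: "integrable M (\<lambda>\<omega>. (B p \<omega> - B 0 \<omega>) * (B q \<omega> - B 0 \<omega>)) \<and>
    (\<integral>\<omega>. (B p \<omega> - B 0 \<omega>) * (B q \<omega> - B 0 \<omega>) \<partial>M) = p" if "0 \<le> p" "p \<le> q" for p q
  proof -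
    have "(\<lambda>\<omega>. B p \<omega> - B 0 \<omega>) \<in> borel_measurable (natural_filtration M B p)"
      using that by (intro borel_measurable_diff borel_measurable_natural_filtration_past) auto
    note past = past_times_increment[OF that this integrable_increment[OF order_refl that(1)]]
    have "(B p \<omega> - B 0 \<omega>) * (B q \<omega> - B 0 \<omega>) =
        (B p \<omega> - B 0 \<omega>)\<^sup>2 + (B p \<omega> - B 0 \<omega>) * (B q \<omega> - B p \<omega>)" for \<omega>
      by (simp add: algebra_simps power2_eq_square)
    then show ?thesis
      using past increment_moments[OF order_refl that(1)] by simp
  qed
  show ?thesis
    using ordered[of p q] ordered[of q p] assms by (cases "p \<le> q") (auto simp: mult.commute)
qed

lemma increment_covariance:
  assumes "0 \<le> a" "a \<le> b" "0 \<le> c" "c \<le> d"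
  shows "integrable M (\<lambda>\<omega>. (B b \<omega> - B a \<omega>) * (B d \<omega> - B c \<omega>))"
    and "(\<integral>\<omega>. (B b \<omega> - B a \<omega>) * (B d \<omega> - B c \<omega>) \<partial>M) =
      (\<integral>s. indicator {a<..b} s * indicator {c<..d} s \<partial>lborel)"
proof -
  let ?W = "\<lambda>p \<omega>. B p \<omega> - B 0 \<omega>"
  have *: "(B b \<omega> - B a \<omega>) * (B d \<omega> - B c \<omega>) =
      ?W b \<omega> * ?W d \<omega> - ?W b \<omega> * ?W c \<omega> - ?W a \<omega> * ?W d \<omega> + ?W a \<omega> * ?W c \<omega>" for \<omega>
    by (simp add: algebra_simps)
  note cov = brownian_covariance[of b d] brownian_covariance[of b c]
    brownian_covariance[of a d] brownian_covariance[of a c]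
  show "integrable M (\<lambda>\<omega>. (B b \<omega> - B a \<omega>) * (B d \<omega> - B c \<omega>))"
    unfolding * using cov assms by (intro Bochner_Integration.integrable_add Bochner_Integration.integrable_diff) auto
  show "(\<integral>\<omega>. (B b \<omega> - B a \<omega>) * (B d \<omega> - B c \<omega>) \<partial>M) =
      (\<integral>s. indicator {a<..b} s * indicator {c<..d} s \<partial>lborel)"
    unfolding * integral_indicator_greaterThanAtMost_product(2)[OF assms(2,4)]
    using cov assms by simp
qed

lemma simple_ito_integral_inner_product:
  assumes "\<forall>i<n. 0 \<le> \<tau> i \<and> \<tau> i \<le> \<tau> (Suc i)" "\<forall>j<m. 0 \<le> \<sigma> j \<and> \<sigma> j \<le> \<sigma> (Suc j)"
  shows "integrable M (\<lambda>\<omega>. simple_ito_integral B n \<tau> (\<lambda>i _. x i) \<omega> * simple_ito_integral B m \<sigma> (\<lambda>j _. y j) \<omega>) \<and>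
    integrable lborel (\<lambda>s. simple_process n \<tau> (\<lambda>i _. x i) s \<omega> * simple_process m \<sigma> (\<lambda>j _. y j) s \<omega>) \<and>
    (\<integral>\<omega>. simple_ito_integral B n \<tau> (\<lambda>i _. x i) \<omega> * simple_ito_integral B m \<sigma> (\<lambda>j _. y j) \<omega> \<partial>M) =
    (\<integral>s. simple_process n \<tau> (\<lambda>i _. x i) s \<omega> * simple_process m \<sigma> (\<lambda>j _. y j) s \<omega> \<partial>lborel)"
proof -
  let ?D = "\<lambda>i j \<omega>. (B (\<tau> (Suc i)) \<omega> - B (\<tau> i) \<omega>) * (B (\<sigma> (Suc j)) \<omega> - B (\<sigma> j) \<omega>)"
  let ?I = "\<lambda>i j s. indicator {\<tau> i<..\<tau> (Suc i)} s * indicator {\<sigma> j<..\<sigma> (Suc j)} s :: real"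
  have S: "simple_ito_integral B n \<tau> (\<lambda>i _. x i) \<omega> * simple_ito_integral B m \<sigma> (\<lambda>j _. y j) \<omega> =
      (\<Sum>i<n. \<Sum>j<m. x i * y j * ?D i j \<omega>)" for \<omega>
    unfolding simple_ito_integral_def sum_product by (intro sum.cong) (auto simp: mult_ac)
  have \<phi>: "simple_process n \<tau> (\<lambda>i _. x i) s \<omega> * simple_process m \<sigma> (\<lambda>j _. y j) s \<omega> =
      (\<Sum>i<n. \<Sum>j<m. x i * y j * ?I i j s)" for s
    unfolding simple_process_def sum_product by (intro sum.cong) (auto simp: mult_ac)
  have D: "integrable M (?D i j)" and I: "integrable lborel (?I i j)"
    and eq: "integral\<^sup>L M (?D i j) = integral\<^sup>L lborel (?I i j)" if "i < n" "j < m" for i j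
    using increment_covariance[of "\<tau> i" "\<tau> (Suc i)" "\<sigma> j" "\<sigma> (Suc j)"]
      integral_indicator_greaterThanAtMost_product(1)[of "\<tau> i" "\<tau> (Suc i)" "\<sigma> j" "\<sigma> (Suc j)"] assms that
    by blast+
  have iS: "integrable M (\<lambda>\<omega>. \<Sum>i<n. \<Sum>j<m. x i * y j * ?D i j \<omega>)"
    by (intro Bochner_Integration.integrable_sum integrable_mult_right D) auto
  have i\<phi>: "integrable lborel (\<lambda>s. \<Sum>i<n. \<Sum>j<m. x i * y j * ?I i j s)"
    by (intro Bochner_Integration.integrable_sum integrable_mult_right I) auto
  have "(\<integral>\<omega>. (\<Sum>i<n. \<Sum>j<m. x i * y j * ?D i j \<omega>) \<partial>M) = (\<Sum>i<n. \<Sum>j<m. x i * y j * integral\<^sup>L M (?D i j))"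
    by (subst Bochner_Integration.integral_sum,
        (intro Bochner_Integration.integrable_sum integrable_mult_right D; auto),
        intro sum.cong refl, subst Bochner_Integration.integral_sum,
        (intro Bochner_Integration.integrable_sum integrable_mult_right D; auto)) simp
  also have "\<dots> = (\<Sum>i<n. \<Sum>j<m. x i * y j * integral\<^sup>L lborel (?I i j))"
    using eq by (intro sum.cong) auto
  also have "\<dots> = (\<integral>s. (\<Sum>i<n. \<Sum>j<m. x i * y j * ?I i j s) \<partial>lborel)"
    by (subst Bochner_Integration.integral_sum,
        (intro Bochner_Integration.integrable_sum integrable_mult_right I; auto),
        intro sum.cong refl, subst Bochner_Integration.integral_sum,
        (intro Bochner_Integration.integrable_sum integrable_mult_right I; auto)) simp
  finally show ?thesis unfolding S \<phi> using iS i\<phi> by blast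
qed

text \<open>Comparing integrals over two unrelated partitions would usually be done on a common refinement;
  bilinearity and the covariance of increments make this unnecessary.\<close>
lemma simple_ito_isometry_diff:
  assumes "\<forall>i<n. 0 \<le> \<tau> i \<and> \<tau> i \<le> \<tau> (Suc i)" "\<forall>j<m. 0 \<le> \<sigma> j \<and> \<sigma> j \<le> \<sigma> (Suc j)"
  shows "(\<integral>\<^sup>+\<omega>. ennreal ((simple_ito_integral B n \<tau> (\<lambda>i _. x i) \<omega> - simple_ito_integral B m \<sigma> (\<lambda>j _. y j) \<omega>)\<^sup>2) \<partial>M) =
    (\<integral>\<^sup>+s. ennreal ((simple_process n \<tau> (\<lambda>i _. x i) s \<omega> - simple_process m \<sigma> (\<lambda>j _. y j) s \<omega>)\<^sup>2) \<partial>lborel)"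
    (is "(\<integral>\<^sup>+\<omega>. ennreal ((?S \<omega> - ?R \<omega>)\<^sup>2) \<partial>M) = (\<integral>\<^sup>+s. ennreal ((?\<phi> s - ?\<psi> s)\<^sup>2) \<partial>lborel)")
proof -
  have sq: "(a - b)\<^sup>2 = a * a - 2 * (a * b) + b * b" for a b :: real
    by (simp add: power2_eq_square algebra_simps)
  note ip = simple_ito_integral_inner_product[OF assms(1,1), of x x \<omega>]
    simple_ito_integral_inner_product[OF assms, of x y \<omega>]
    simple_ito_integral_inner_product[OF assms(2,2), of y y \<omega>]
  have int: "integrable M (\<lambda>\<omega>. (?S \<omega> - ?R \<omega>)\<^sup>2)" "integrable lborel (\<lambda>s. (?\<phi> s - ?\<psi> s)\<^sup>2)"
    unfolding sq using ip by simp_all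
  have "(\<integral>\<^sup>+\<omega>. ennreal ((?S \<omega> - ?R \<omega>)\<^sup>2) \<partial>M) = ennreal (\<integral>\<omega>. (?S \<omega> - ?R \<omega>)\<^sup>2 \<partial>M)"
    using int(1) by (rule nn_integral_eq_integral) simp
  also have "(\<integral>\<omega>. (?S \<omega> - ?R \<omega>)\<^sup>2 \<partial>M) = (\<integral>s. (?\<phi> s - ?\<psi> s)\<^sup>2 \<partial>lborel)"
    unfolding sq using ip by simp
  also have "ennreal \<dots> = (\<integral>\<^sup>+s. ennreal ((?\<phi> s - ?\<psi> s)\<^sup>2) \<partial>lborel)"
    using int(2) by (rule nn_integral_eq_integral[symmetric]) simp
  finally show ?thesis .
qed

text \<open>After passing to a subsequence \<open>r\<close> along which the squared distance of the step functions to \<open>u\<close> is at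
  most \<open>(1/4) ^ k\<close>, their integrals satisfy the hypothesis of \<open>L2_complete\<close> with \<open>c = 4\<close>.\<close>
lemma ito_integral_exists_deterministic:
  fixes u :: "real \<Rightarrow> real" and n :: "nat \<Rightarrow> nat" and \<tau> x :: "nat \<Rightarrow> nat \<Rightarrow> real"
  assumes u[measurable]: "u \<in> borel_measurable borel"
    and part: "\<And>k. 0 \<le> \<tau> k 0" "\<And>k. \<tau> k (n k) \<le> t" "\<And>k i. i < n k \<Longrightarrow> \<tau> k i \<le> \<tau> k (Suc i)"
    and lim: "(\<lambda>k. \<integral>\<^sup>+s\<in>{0..t}. ennreal ((u s - (\<Sum>i<n k. x k i * indicator {\<tau> k i<..\<tau> k (Suc i)} s))\<^sup>2) \<partial>lborel)
      \<longlonglongrightarrow> 0"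
  shows "\<exists>X. is_ito_integral M B t (\<lambda>s _. u s) X"
proof -
  let ?L = "restrict_space lborel {0..t}"
  let ?\<phi> = "\<lambda>k s. \<Sum>i<n k. x k i * indicator {\<tau> k i<..\<tau> k (Suc i)} s"
  let ?e = "\<lambda>k. \<integral>\<^sup>+s\<in>{0..t}. ennreal ((u s - ?\<phi> k s)\<^sup>2) \<partial>lborel"
  let ?S = "\<lambda>k. simple_ito_integral B (n k) (\<tau> k) (\<lambda>i _. x k i)"
  have \<phi>: "simple_process (n k) (\<tau> k) (\<lambda>i _. x k i) s \<omega> = ?\<phi> k s" for k s and \<omega> :: 'a
    by (simp add: simple_process_def)
  have mono: "\<forall>i<n k. \<tau> k i \<le> \<tau> k (Suc i)" for k using part by simp
  have pos: "\<forall>i<n k. 0 \<le> \<tau> k i \<and> \<tau> k i \<le> \<tau> k (Suc i)" for k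
    using partition_mono[OF mono, of 0 _ k] part by (meson le0 less_imp_le order_trans)
  have ad: "adapted_simple M B t (n k) (\<tau> k) (\<lambda>i _. x k i)" for k
  proof -
    have "bounded ((\<lambda>_. c) ` space M)" for c :: real by (rule bounded_subset[of "{c}"]) auto
    then show ?thesis using part by (simp add: adapted_simple_def)
  qed
  have S: "?S k \<in> borel_measurable M \<and> integrable M (\<lambda>\<omega>. (?S k \<omega>)\<^sup>2)" for k
  proof -
    have "\<forall>i<n k. (\<lambda>_. x k i) \<in> borel_measurable (natural_filtration M B (\<tau> k i)) \<and> bounded ((\<lambda>_. x k i) ` space M)"
      using ad[of k] unfolding adapted_simple_def by (elim conjE)
    from simple_ito_integral_moments[OF part(1) mono this]
    have "?S k \<in> borel_measurable (natural_filtration M B (\<tau> k (n k)))" "integrable M (\<lambda>\<omega>. (?S k \<omega>)\<^sup>2)"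
      by (simp_all only:)
    from borel_measurable_of_natural_filtration[OF this(1)] this(2) show ?thesis ..
  qed
  then have [measurable]: "?S k \<in> borel_measurable M" for k by simp
  have supp: "?\<phi> k s = 0" if "s \<notin> {0..t}" for k s
  proof (intro sum.neutral ballI)
    fix i assume i: "i \<in> {..<n k}"
    then have "0 \<le> \<tau> k i" "\<tau> k (Suc i) \<le> t"
      using pos[of k] partition_mono[OF mono, of "Suc i" "n k" k] part(2)[of k] by auto
    then show "x k i * indicator {\<tau> k i<..\<tau> k (Suc i)} s = 0"
      using that by (auto simp: indicator_def)
  qed
  have diff: "(\<integral>\<^sup>+\<omega>. ennreal ((?S j \<omega> - ?S k \<omega>)\<^sup>2) \<partial>M) \<le> 2 * ?e k + 2 * ?e j" for j k
  proof -
    have "(\<integral>\<^sup>+\<omega>. ennreal ((?S j \<omega> - ?S k \<omega>)\<^sup>2) \<partial>M) = (\<integral>\<^sup>+s. ennreal ((?\<phi> j s - ?\<phi> k s)\<^sup>2) \<partial>lborel)"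
      using simple_ito_isometry_diff[OF pos[of j] pos[of k], where x="x j" and y="x k" and \<omega>="undefined :: 'a"]
      by (simp only: \<phi>)
    also have "\<dots> = (\<integral>\<^sup>+s\<in>{0..t}. ennreal ((?\<phi> j s - ?\<phi> k s)\<^sup>2) \<partial>lborel)"
    proof (rule nn_integral_cong)
      fix s show "ennreal ((?\<phi> j s - ?\<phi> k s)\<^sup>2) = ennreal ((?\<phi> j s - ?\<phi> k s)\<^sup>2) * indicator {0..t} s"
      proof (cases "s \<in> {0..t}")
        case True
        then show ?thesis by (simp only: indicator_simps mult_1_right)
      next
        case False
        show ?thesis unfolding supp[OF False] by simp
      qed
    qed
    also have "\<dots> = (\<integral>\<^sup>+s. ennreal ((?\<phi> j s - ?\<phi> k s)\<^sup>2) \<partial>?L)"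
      by (simp add: nn_integral_restrict_space)
    also have "\<dots> \<le> ennreal (1 + 1) * (\<integral>\<^sup>+s. ennreal ((u s - ?\<phi> k s)\<^sup>2) \<partial>?L) +
        ennreal (1 + 1 / 1) * (\<integral>\<^sup>+s. ennreal ((?\<phi> j s - ?\<phi> k s - (u s - ?\<phi> k s))\<^sup>2) \<partial>?L)"
      by (intro nn_integral_power2_le_weighted measurable_restrict_space1; (rule zero_less_one | measurable))
    also have "\<dots> = 2 * ?e k + 2 * ?e j"
    proof -
      have "(a - b - (c - b))\<^sup>2 = (c - a)\<^sup>2" for a b c :: real by (simp add: power2_commute)
      then show ?thesis by (simp only:) (simp add: nn_integral_restrict_space)
    qed
    finally show ?thesis .
  qed
  have "\<forall>k. \<exists>m. ?e m \<le> ennreal ((1/4) ^ k)"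
  proof
    fix k
    have "eventually (\<lambda>m. ?e m < ennreal ((1/4) ^ k)) sequentially"
      by (rule order_tendstoD(2)[OF lim]) simp
    from eventually_happens'[OF sequentially_bot this]
    show "\<exists>m. ?e m \<le> ennreal ((1/4) ^ k)" by (blast intro: less_imp_le)
  qed
  from choice[OF this] obtain r where r': "\<forall>k. ?e (r k) \<le> ennreal ((1/4) ^ k)" by blast
  note r = r'[rule_format]
  have cauchy: "(\<integral>\<^sup>+\<omega>. ennreal ((?S (r j) \<omega> - ?S (r k) \<omega>)\<^sup>2) \<partial>M) \<le> ennreal (4 * (1/4) ^ k)"
    if "k \<le> j" for j k
  proof -
    note diff[of "r j" "r k"]
    also have "2 * ?e (r k) + 2 * ?e (r j) \<le> 2 * ennreal ((1/4) ^ k) + 2 * ennreal ((1/4) ^ k)"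
      using that by (intro add_mono mult_left_mono r order_trans[OF r] ennreal_leI power_decreasing) auto
    also have "\<dots> = ennreal 2 * ennreal ((1/4) ^ k) + ennreal 2 * ennreal ((1/4) ^ k)" by simp
    also have "\<dots> = ennreal (4 * (1/4) ^ k)"
      by (simp only: ennreal_mult[symmetric] ennreal_plus[symmetric] zero_le_numeral zero_le_power
          zero_le_divide_1_iff mult_nonneg_nonneg) simp
    finally show ?thesis .
  qed
  obtain X where X[measurable]: "X \<in> borel_measurable M"
    and XS: "\<And>k. (\<integral>\<^sup>+\<omega>. ennreal ((X \<omega> - ?S (r k) \<omega>)\<^sup>2) \<partial>M) \<le> ennreal (4 * (1/4) ^ k)"
    using L2_complete[of "\<lambda>k. ?S (r k)" 4, OF _ _ cauchy] by auto
  have "(\<integral>\<^sup>+\<omega>. ennreal ((X \<omega>)\<^sup>2) \<partial>M) \<le> ennreal (1 + 1) * (\<integral>\<^sup>+\<omega>. ennreal ((?S (r 0) \<omega>)\<^sup>2) \<partial>M) +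
      ennreal (1 + 1 / 1) * (\<integral>\<^sup>+\<omega>. ennreal ((X \<omega> - ?S (r 0) \<omega>)\<^sup>2) \<partial>M)"
    by (intro nn_integral_power2_le_weighted) auto
  also have "\<dots> < \<infinity>"
    using S[of "r 0"] le_less_trans[OF XS[of 0] ennreal_less_top]
    by (simp add: nn_integral_eq_integral ennreal_mult_less_top)
  finally have sq: "integrable M (\<lambda>\<omega>. (X \<omega>)\<^sup>2)" by (intro integrableI_bounded) auto
  have lim_u: "(\<lambda>k. \<integral>\<^sup>+\<omega>. (?e (r k)) \<partial>M) \<longlonglongrightarrow> 0"
  proof -
    have "(\<lambda>k. ennreal ((1/4) ^ k)) \<longlonglongrightarrow> ennreal 0"
      by (intro tendsto_ennrealI LIMSEQ_realpow_zero) auto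
    then have "(\<lambda>k. ?e (r k)) \<longlonglongrightarrow> 0"
      unfolding ennreal_0 by (rule ennreal_tendsto_0_mono[OF _ r])
    then show ?thesis by (simp only: nn_integral_const emeasure_space_1 mult_1_right)
  qed
  have lim_X: "(\<lambda>k. \<integral>\<^sup>+\<omega>. ennreal ((X \<omega> - ?S (r k) \<omega>)\<^sup>2) \<partial>M) \<longlonglongrightarrow> 0"
  proof -
    have "(\<lambda>k. ennreal (4 * (1/4) ^ k)) \<longlonglongrightarrow> ennreal (4 * 0)"
      by (intro tendsto_ennrealI tendsto_intros LIMSEQ_realpow_zero) auto
    then show ?thesis
      unfolding mult_zero_right ennreal_0 by (rule ennreal_tendsto_0_mono[OF _ XS])
  qed
  have meas: "case_prod (\<lambda>s _. u s) \<in> borel_measurable (restrict_space borel {0..t} \<Otimes>\<^sub>M M)"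
    unfolding case_prod_beta
    by (rule measurable_compose[OF measurable_fst measurable_restrict_space1[OF u]])
  have lim_u': "(\<lambda>k. \<integral>\<^sup>+\<omega>. (\<integral>\<^sup>+s\<in>{0..t}.
      ennreal ((u s - simple_process (n (r k)) (\<tau> (r k)) (\<lambda>i _. x (r k) i) s \<omega>)\<^sup>2) \<partial>lborel) \<partial>M) \<longlonglongrightarrow> 0"
    unfolding \<phi> by (rule lim_u)
  have "\<exists>n \<tau> \<xi>. (\<forall>k. adapted_simple M B t (n k) (\<tau> k) (\<xi> k)) \<and>
      (\<lambda>k. \<integral>\<^sup>+\<omega>. (\<integral>\<^sup>+s\<in>{0..t}.
          ennreal ((u s - simple_process (n k) (\<tau> k) (\<xi> k) s \<omega>)\<^sup>2) \<partial>lborel) \<partial>M) \<longlonglongrightarrow> 0 \<and>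
      (\<lambda>k. \<integral>\<^sup>+\<omega>. ennreal ((X \<omega> - simple_ito_integral B (n k) (\<tau> k) (\<xi> k) \<omega>)\<^sup>2) \<partial>M) \<longlonglongrightarrow> 0"
    by (rule exI[of _ "\<lambda>k. n (r k)"], rule exI[of _ "\<lambda>k. \<tau> (r k)"],
        rule exI[of _ "\<lambda>k i _. x (r k) i"]) (intro conjI allI ad lim_u' lim_X)
  then have "is_ito_integral M B t (\<lambda>s _. u s) X"
    unfolding is_ito_integral_def by (intro conjI ballI meas X sq borel_measurable_const)
  then show ?thesis by (rule exI[of _ X])
qed

end

section \<open>The power kernel\<close>

lemma nn_integral_power_kernel:
  fixes t h :: real
  assumes "0 \<le> t" "0 < h"
  shows "(\<integral>\<^sup>+s\<in>{0..t}. ennreal (((t - s) powr (h - 1/2))\<^sup>2) \<partial>lborel) = ennreal (t powr (2 * h) / (2 * h))"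
proof -
  let ?g = "\<lambda>x. if x \<in> {0..t} then x powr (2 * h - 1) else 0 :: real"
  have sq: "((t - s) powr (h - 1/2))\<^sup>2 = (t - s) powr (2 * h - 1)" for s
    by (simp add: power2_eq_square powr_add[symmetric])
  have "(\<integral>\<^sup>+s\<in>{0..t}. ennreal (((t - s) powr (h - 1/2))\<^sup>2) \<partial>lborel) = (\<integral>\<^sup>+s. ennreal (?g (t + (-1) * s)) \<partial>lborel)"
    unfolding sq by (intro nn_integral_cong) (auto simp: indicator_def)
  also have "\<dots> = (\<integral>\<^sup>+s. ennreal (?g s) \<partial>lborel)"
    by (subst (2) nn_integral_real_affine[where c="-1" and t=t]) auto
  also have "\<dots> = ennreal (t powr (2 * h) / (2 * h))"
  proof (rule nn_integral_has_integral_lborel)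
    have "((\<lambda>x. x powr (2 * h - 1)) has_integral (t powr (2 * h) / (2 * h))) {0..t}"
      using has_integral_powr_from_0[of "2 * h - 1" t] assms by simp
    then show "(?g has_integral (t powr (2 * h) / (2 * h))) UNIV"
      by (simp only: has_integral_restrict_UNIV)
  qed auto
  finally show ?thesis .
qed

text \<open>On \<open>[0, t)\<close> the kernel decreases for \<open>a \<ge> 0\<close> and increases for \<open>a < 0\<close>, so the smaller endpoint value is
  a lower bound. For \<open>a < 0\<close> and \<open>q = t\<close> the convention \<open>0 powr a = 0\<close> makes the bound trivial exactly
  where the kernel blows up.\<close>
lemma power_kernel_ge_min:
  fixes a p q s t :: real
  assumes "p < s" "s \<le> q" "q \<le> t"
  shows "min ((t - p) powr a) ((t - q) powr a) \<le> (t - s) powr a"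
proof (cases "0 \<le> a")
  case True
  then have "(t - q) powr a \<le> (t - s) powr a" using assms by (intro powr_mono2) auto
  then show ?thesis by simp
next
  case False
  show ?thesis
  proof (cases "q = t")
    case True
    then show ?thesis by simp
  next
    case q: False
    then have "(t - p) powr a \<le> (t - s) powr a" using False assms by (intro powr_mono2') auto
    then show ?thesis by simp
  qed
qed

text \<open>The step functions lie between \<open>0\<close> and the kernel, so the squared kernel dominates the squared error,
  and they converge pointwise inside \<open>(0, t)\<close> by continuity.\<close>
lemma power_kernel_step_approximation:
  fixes t a :: real
  assumes t: "0 < t"
    and fin: "(\<integral>\<^sup>+s\<in>{0..t}. ennreal (((t - s) powr a)\<^sup>2) \<partial>lborel) < \<infinity>"
  defines "\<tau> \<equiv> \<lambda>k i. real i * t / real (Suc k)"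
  defines "x \<equiv> \<lambda>k i. min ((t - \<tau> k i) powr a) ((t - \<tau> k (Suc i)) powr a)"
  shows "(\<lambda>k. \<integral>\<^sup>+s\<in>{0..t}.
      ennreal (((t - s) powr a - (\<Sum>i<Suc k. x k i * indicator {\<tau> k i<..\<tau> k (Suc i)} s))\<^sup>2) \<partial>lborel)
    \<longlonglongrightarrow> 0"
proof -
  let ?f = "\<lambda>s. (t - s) powr a"
  let ?\<phi> = "\<lambda>k s. \<Sum>i<Suc k. x k i * indicator {\<tau> k i<..\<tau> k (Suc i)} s"
  have \<tau>0: "\<tau> k 0 = 0" and \<tau>n: "\<tau> k (Suc k) = t" for k by (auto simp: \<tau>_def)
  have step: "\<exists>i. \<tau> k i < s \<and> s \<le> \<tau> k (Suc i) \<and> \<tau> k (Suc i) \<le> t \<and> \<tau> k (Suc i) - \<tau> k i = t / real (Suc k) \<and> ?\<phi> k s = x k i"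
    if s: "0 < s" "s \<le> t" for s k
  proof -
    \<comment> \<open>The interval containing \<open>s\<close> is the one that ends at \<open>\<tau> k m\<close>.\<close>
    define m where "m = nat \<lceil>s * real (Suc k) / t\<rceil>"
    have pos: "0 < s * real (Suc k) / t" using s t by (intro divide_pos_pos mult_pos_pos) auto
    have "s * real (Suc k) \<le> t * real (Suc k)" using s by (intro mult_right_mono) auto
    then have le: "s * real (Suc k) / t \<le> real (Suc k)" using t by (simp add: pos_divide_le_eq mult.commute)
    have m: "real m - 1 < s * real (Suc k) / t" "s * real (Suc k) / t \<le> real m"
      using pos unfolding m_def by linarith+
    have "m \<le> Suc k" using le unfolding m_def by (simp add: ceiling_le_iff)
    have "0 < m" using pos m(2) by (cases m) auto
    then obtain i where i: "m = Suc i" by (cases m) auto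
    have *: "\<tau> k j < s \<longleftrightarrow> real j < s * real (Suc k) / t" for j
      using t unfolding \<tau>_def by (simp add: field_simps)
    have in_iff: "s \<in> {\<tau> k j<..\<tau> k (Suc j)} \<longleftrightarrow> j = i" for j
    proof -
      have "s \<in> {\<tau> k j<..\<tau> k (Suc j)} \<longleftrightarrow> real j < s * real (Suc k) / t \<and> \<not> real (Suc j) < s * real (Suc k) / t"
        using *[of j] *[of "Suc j"] by (auto simp: not_less)
      also have "\<dots> \<longleftrightarrow> j = i" using m i by auto
      finally show ?thesis .
    qed
    have "?\<phi> k s = (\<Sum>j<Suc k. if j = i then x k i else 0)"
      by (intro sum.cong) (auto simp: indicator_def in_iff[simplified])
    also have "\<dots> = x k i" using \<open>m \<le> Suc k\<close> i by (subst sum.delta) auto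
    finally have "?\<phi> k s = x k i" .
    moreover have "\<tau> k (Suc i) \<le> t"
      using \<open>m \<le> Suc k\<close> i t unfolding \<tau>_def by (simp add: field_simps)
    moreover have "\<tau> k (Suc i) - \<tau> k i = t / real (Suc k)"
      unfolding \<tau>_def diff_divide_distrib[symmetric] by (simp add: distrib_right)
    moreover have "\<tau> k i < s" "s \<le> \<tau> k (Suc i)"
      using in_iff[of i] by simp_all
    ultimately show ?thesis by blast
  qed
  have meas[measurable]: "?f \<in> borel_measurable borel" "?\<phi> k \<in> borel_measurable borel" for k
    by measurable
  have AE: "AE s in lborel. s \<noteq> 0 \<and> s \<noteq> t"
    using AE_lborel_singleton[of 0] AE_lborel_singleton[of t] by eventually_elim simp
  have "(\<lambda>k. \<integral>\<^sup>+s. ennreal ((?f s - ?\<phi> k s)\<^sup>2) * indicator {0..t} s \<partial>lborel)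
      \<longlonglongrightarrow> (\<integral>\<^sup>+s. (0::ennreal) \<partial>(lborel :: real measure))"
  proof (rule nn_integral_dominated_convergence[where w="\<lambda>s. ennreal ((?f s)\<^sup>2) * indicator {0..t} s"])
    show "AE s in lborel. ennreal ((?f s - ?\<phi> k s)\<^sup>2) * indicator {0..t} s \<le> ennreal ((?f s)\<^sup>2) * indicator {0..t} s" for k
      using AE
    proof eventually_elim
      fix s assume s: "s \<noteq> 0 \<and> s \<noteq> t"
      show "ennreal ((?f s - ?\<phi> k s)\<^sup>2) * indicator {0..t} s \<le> ennreal ((?f s)\<^sup>2) * indicator {0..t} s"
      proof (cases "s \<in> {0..t}")
        case True
        with s have "0 < s" "s \<le> t" by auto
        from step[OF this, of k] obtain i where i: "\<tau> k i < s" "s \<le> \<tau> k (Suc i)" "\<tau> k (Suc i) \<le> t" "?\<phi> k s = x k i"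
          by blast
        have "0 \<le> x k i" by (simp add: x_def)
        moreover have "x k i \<le> ?f s" unfolding x_def by (rule power_kernel_ge_min[OF i(1-3)])
        ultimately have "(?f s - x k i)\<^sup>2 \<le> (?f s)\<^sup>2" by (intro power_mono) auto
        then show ?thesis unfolding i(4) using True by (simp add: ennreal_leI)
      qed simp
    qed
    show "AE s in lborel. (\<lambda>k. ennreal ((?f s - ?\<phi> k s)\<^sup>2) * indicator {0..t} s) \<longlonglongrightarrow> 0"
      using AE
    proof eventually_elim
      fix s assume s: "s \<noteq> 0 \<and> s \<noteq> t"
      show "(\<lambda>k. ennreal ((?f s - ?\<phi> k s)\<^sup>2) * indicator {0..t} s) \<longlonglongrightarrow> 0"
      proof (cases "s \<in> {0..t}")
        case True
        with s have st: "0 < s" "s \<le> t" "s < t" by auto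
        from choice[OF allI[OF step[OF st(1,2)]]] obtain i where
          i': "\<forall>k. \<tau> k (i k) < s \<and> s \<le> \<tau> k (Suc (i k)) \<and> \<tau> k (Suc (i k)) \<le> t \<and>
            \<tau> k (Suc (i k)) - \<tau> k (i k) = t / real (Suc k) \<and> ?\<phi> k s = x k (i k)" ..
        have i: "\<tau> k (i k) < s" "s \<le> \<tau> k (Suc (i k))"
          "\<tau> k (Suc (i k)) - \<tau> k (i k) = t / real (Suc k)" "?\<phi> k s = x k (i k)" for k
          using i'[rule_format, of k] by blast+
        have mesh: "(\<lambda>k. t / real (Suc k)) \<longlonglongrightarrow> 0"
          using tendsto_mult[OF tendsto_const[of t] LIMSEQ_inverse_real_of_nat] by (simp add: divide_inverse)
        have l: "(\<lambda>k. \<tau> k (i k)) \<longlonglongrightarrow> s"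
        proof (rule tendsto_sandwich[OF always_eventually always_eventually])
          show "(\<lambda>k. s - t / real (Suc k)) \<longlonglongrightarrow> s" using tendsto_diff[OF tendsto_const[of s] mesh] by simp
          show "\<forall>k. s - t / real (Suc k) \<le> \<tau> k (i k)" 
          proof
            fix k show "s - t / real (Suc k) \<le> \<tau> k (i k)" using i(2,3)[of k] by linarith
          qed
          show "\<forall>k. \<tau> k (i k) \<le> s" using i(1) less_imp_le by blast
        qed simp
        have "(\<lambda>k. \<tau> k (i k) + t / real (Suc k)) \<longlonglongrightarrow> s + 0" by (intro tendsto_add l mesh)
        moreover have "\<tau> k (i k) + t / real (Suc k) = \<tau> k (Suc (i k))" for k using i(3)[of k] by simp
        ultimately have l': "(\<lambda>k. \<tau> k (Suc (i k))) \<longlonglongrightarrow> s" by simp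
        have "(\<lambda>k. x k (i k)) \<longlonglongrightarrow> min (?f s) (?f s)"
          unfolding x_def using st by (intro tendsto_min tendsto_powr tendsto_diff tendsto_const l l') auto
        then have "(\<lambda>k. ennreal ((?f s - x k (i k))\<^sup>2)) \<longlonglongrightarrow> ennreal ((?f s - ?f s)\<^sup>2)"
          by (intro tendsto_ennrealI tendsto_intros) simp
        then show ?thesis using True unfolding i(4) by simp
      qed simp
    qed
    show "(\<lambda>s. ennreal ((?f s - ?\<phi> k s)\<^sup>2) * indicator {0..t} s) \<in> borel_measurable lborel" for k
      by measurable
    show "(\<integral>\<^sup>+s\<in>{0..t}. ennreal ((?f s)\<^sup>2) \<partial>lborel) < \<infinity>" by (rule fin)
  qed measurable
  then show ?thesis by simp
qed

lemma (in standard_brownian_motion) power_kernel_ito_integral_exists: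
  assumes "0 \<le> t" "0 < h"
  shows "\<exists>X. is_ito_integral M B t (\<lambda>s _. (t - s) powr (h - 1/2)) X"
proof (cases "t = 0")
  case True
  show ?thesis
  proof (rule ito_integral_exists_deterministic[where n="\<lambda>_. 0" and \<tau>="\<lambda>_ _. 0" and x="\<lambda>_ _. 0"])
    show "(\<lambda>k. \<integral>\<^sup>+s\<in>{0..t}. ennreal (((t - s) powr (h - 1/2) - (\<Sum>i<0. 0 * indicator {0<..0} s))\<^sup>2) \<partial>lborel) \<longlonglongrightarrow> 0"
      using nn_integral_power_kernel[OF assms] True by simp
  qed (use True in auto)
next
  case False
  then have t: "0 < t" using assms by simp
  have "(\<integral>\<^sup>+s\<in>{0..t}. ennreal (((t - s) powr (h - 1/2))\<^sup>2) \<partial>lborel) < \<infinity>"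
    by (simp only: nn_integral_power_kernel[OF assms]) simp
  from power_kernel_step_approximation[OF t this] show ?thesis
    by (rule ito_integral_exists_deterministic[rotated 4]) (use t in \<open>auto simp: field_simps\<close>)
qed

section \<open>The second moment of time-varying fractional Brownian motion\<close>

theorem theorem3p1:
  fixes M :: "'a measure" and B :: "real \<Rightarrow> 'a \<Rightarrow> real"
    and H :: "real \<Rightarrow> real" and T \<gamma> t :: real
  assumes "standard_brownian_motion M B"
    and "T > 0"
    and "\<forall>s\<in>{0..T}. 0 < H s \<and> H s < 1"
    and "holder_continuous_on {0..T} \<gamma> H"
    and "\<gamma> > (SUP s\<in>{0..T}. H s)"
    and "t \<in> {0..T}"
  shows "(\<integral>\<omega>. (tv_fbm M B H t \<omega>)\<^sup>2 \<partial>M) = t powr (2 * H t)"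
proof -
  interpret standard_brownian_motion M B by fact
  have t: "0 \<le> t" and H: "0 < H t" using assms by auto
  let ?u = "\<lambda>s (_::'a). (t - s) powr (H t - 1/2)"
  define X where "X = ito_integral M B t ?u"
  have X: "is_ito_integral M B t ?u X"
    unfolding X_def ito_integral_def by (rule someI_ex[OF power_kernel_ito_integral_exists[OF t H]])
  then have "integrable M (\<lambda>\<omega>. (X \<omega>)\<^sup>2)" by (simp add: is_ito_integral_def)
  then have "ennreal (\<integral>\<omega>. (X \<omega>)\<^sup>2 \<partial>M) = (\<integral>\<^sup>+\<omega>. ennreal ((X \<omega>)\<^sup>2) \<partial>M)"
    by (simp add: nn_integral_eq_integral)
  also have "\<dots> = ennreal (t powr (2 * H t) / (2 * H t))"
    by (simp only: ito_isometry[OF X] nn_integral_power_kernel[OF t H]) (simp add: emeasure_space_1)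
  finally have "(\<integral>\<omega>. (X \<omega>)\<^sup>2 \<partial>M) = t powr (2 * H t) / (2 * H t)"
    using H by (subst (asm) ennreal_inj) auto
  then show ?thesis
    using H by (simp add: tv_fbm_def X_def[symmetric] power_mult_distrib)
qed

end
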